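(* Let $sc_n=\dim\mathbf{SC}_n$ and let $F(x)=\sum_{n\ge0}sc_n\frac{x^n}{n!}$. The dimension of $\mathbf{SC}_n$ has an asymptotic growth of $$sc_n=n!\,\gamma^{-n}\left(\tau+o(\delta^{-n})\right),$$ where $\delta<1$ is some real number, $\gamma\approx0.814097\approx1.1745\log(2)$ is the unique positive root of the equation $$e^{2x}=1+(1+x)e^x,$$ and $\tau=\mathrm{Res}_{\gamma}(F)\approx0.588175$ is the residue of the function $F$ at $\gamma$.
   Context: $[n]=\{1,\dots,n\}$. A set composition of $[n]$ is an ordered list $\vec{\boldsymbol{\pi}}=S_1|\cdots|S_k$ of non-empty disjoint sets with union $[n]$; $\mathbf{C}_n$ is the set of these. For non-empty $A\subseteq[n]$, $A_{\vec{\boldsymbol{\pi}}}=A\cap S_i$ with $i$ the smallest index such that $A\cap S_i\neq\emptyset$. Define $\vec{\boldsymbol{\pi}}\sim\vec{\boldsymbol{\tau}}$ if for every non-empty $A\subseteq[n]$: $\#A_{\vec{\boldsymbol{\pi}}}=1\Leftrightarrow\#A_{\vec{\boldsymbol{\tau}}}=1$. $\mathbf{SC}_n$ is the span of the linearly independent elements $\mathbf{N}_{[\vec{\boldsymbol{\pi}}]}=\sum_{\vec{\boldsymbol{\tau}}\sim\vec{\boldsymbol{\pi}}}\mathbf{M}_{\vec{\boldsymbol{\tau}}}$, $[\vec{\boldsymbol{\pi}}]\in\mathbf{C}_n/\!\sim$, where $\{\mathbf{M}_{\vec{\boldsymbol{\tau}}}\}_{\vec{\boldsymbol{\tau}}\in\mathbf{C}_n}$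 is the monomial basis of the degree-$n$ component of the algebra $\mathbf{WQSym}$ of word quasisymmetric functions; thus $sc_n$ is the number of equivalence classes of $\sim$ on $\mathbf{C}_n$. $\mathbf{SC}$ is the graded vector space with homogeneous components $\mathbf{SC}_n$. The series $F$ equals the meromorphic function $F(x)=\dfrac{e^x}{1+(1+x)e^x-e^{2x}}$.
   Formalization: The residue of F at γ is about −0.588175, so τ is taken as −Res_γ(F) ≈ 0.588175; besides the printed display with o(δ^{-n}), the sharper sc_n = n! γ^{-n}(τ/γ + o(δ^n)) with 0<δ<1 is stated. *)

theory Defs
  imports
    "HOL-Complex_Analysis.Complex_Analysis"
    "HOL-Library.Function_Algebras"
    "HOL-Library.Landau_Symbols"
begin

section \<open>Set compositions and the equivalence relation\<close>

definition set_compositions :: "nat \<Rightarrow> nat set list set" where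
  "set_compositions n = {P. distinct P \<and> partition_on {1..n} (set P)}"

definition min_part :: "nat set \<Rightarrow> nat set list \<Rightarrow> nat set" where
  "min_part A P = A \<inter> P ! (LEAST i. i < length P \<and> A \<inter> P ! i \<noteq> {})"

definition sc_rel :: "nat \<Rightarrow> (nat set list \<times> nat set list) set" where
  "sc_rel n = {(P, Q). P \<in> set_compositions n \<and> Q \<in> set_compositions n \<and>
     (\<forall>A. A \<subseteq> {1..n} \<and> A \<noteq> {} \<longrightarrow> (card (min_part A P) = 1 \<longleftrightarrow> card (min_part A Q) = 1))}"


section \<open>The graded space \<open>SC\<close> inside the word quasisymmetric functions\<close>

text \<open>
  A formal power series in the noncommuting variables $a_0, a_1, a_2, \ldots$ with coefficients
  in a field is given by its coefficient function on words; a word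
  $a_{w_1} \cdots a_{w_n}$ is the list \<open>[w\<^sub>1, \<dots>, w\<^sub>n]\<close> of its indices.
  The vector space operations are pointwise.
\<close>

type_synonym 'k ncseries = "nat list \<Rightarrow> 'k"

definition ncscale :: "'k::field \<Rightarrow> 'k ncseries \<Rightarrow> 'k ncseries" where
  "ncscale c f = (\<lambda>w. c * f w)"

global_interpretation nc: vector_space "ncscale :: 'k::field \<Rightarrow> 'k ncseries \<Rightarrow> 'k ncseries"
  by unfold_locales (auto simp: ncscale_def fun_eq_iff algebra_simps)

text \<open>
  The set composition of a word: the blocks are the sets of (1-based) positions that carry the
  same letter, listed by increasing letter.
\<close>

definition word_composition :: "nat list \<Rightarrow> nat set list" where
  "word_composition w =
     map (\<lambda>a. {i \<in> {1..length w}. w ! (i - 1) = a}) (sorted_list_of_set (set w))"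

definition M_basis :: "nat set list \<Rightarrow> 'k::field ncseries" where
  "M_basis P = (\<lambda>w. if word_composition w = P then 1 else 0)"

definition N_basis :: "nat set list set \<Rightarrow> 'k::field ncseries" where
  "N_basis C = (\<Sum>Q\<in>C. M_basis Q)"

definition SC :: "nat \<Rightarrow> 'k::field ncseries set" where
  "SC n = nc.span (N_basis ` (set_compositions n // sc_rel n))"

definition sc_dim :: "'k::field itself \<Rightarrow> nat \<Rightarrow> nat" where
  "sc_dim _ n = nc.dim (SC n :: 'k ncseries set)"


section \<open>The generating function\<close>

text \<open>
  The meromorphic continuation to the plane of the exponential generating function
  $\sum_n sc_n x^n / n!$.

  Its only positive pole \<open>\<gamma>\<close> is simple, and
  $\mathrm{Res}_\gamma(F) = 1 / (2 + \gamma - 2 e^\gamma) \approx -0.588175$ is negative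
  with the usual normalisation $F(x) \sim \mathrm{Res}_\gamma(F) / (x - \gamma)$.
  The positive number $\tau \approx 0.588175$ is therefore $-\mathrm{Res}_\gamma(F)$, that is,
  $F(x) \sim \tau / (\gamma - x)$, and hence
  $sc_n / n! \sim \tau \gamma^{-n-1} = \gamma^{-n} \cdot \tau / \gamma$.
\<close>

definition sc_egf :: "complex \<Rightarrow> complex" where
  "sc_egf x = exp x / (1 + (1 + x) * exp x - exp (2 * x))"

end

theory Submission
  imports Defs
begin

text \<open>
  A set composition is determined up to equivalence by its list of blocks once each maximal run of
  consecutive singletons is replaced by the set of its elements. Removing the initial run and the
  first larger block gives \<open>F = e\<^sup>x (1 + (e\<^sup>x - 1 - x) F)\<close>, that is,
  \<open>F = 1 / (1 - g)\<close> with \<open>g(x) = e\<^sup>x - e\<^sup>-\<^sup>x - x\<close>.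
  Since \<open>g(x)\<close> has non-negative Taylor coefficients and a non-zero linear one, the only solution of
  \<open>g(z) = 1\<close> in the disc \<open>\<bar>z\<bar> \<le> \<gamma>\<close> is \<open>\<gamma>\<close> itself, and by compactness this persists in a slightly
  larger disc. Subtracting the simple pole at \<open>\<gamma>\<close> leaves a function holomorphic in that disc,
  whose coefficients are exponentially smaller than \<open>\<gamma>\<^sup>-\<^sup>n\<close>.
\<close>

section \<open>The dimension as a number of classes\<close>

lemma N_basis_apply:
  assumes "finite C"
  shows "(N_basis C :: 'k::field ncseries) w = (if word_composition w \<in> C then 1 else 0)"
  unfolding N_basis_def using assms
  by (induction C rule: finite_induct) (auto simp: M_basis_def)

lemma finite_set_compositions: "finite (set_compositions n)"
proof (rule finite_subset)
  show "set_compositions n \<subseteq> {P. set P \<subseteq> Pow {1..n} \<and> distinct P}"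
    by (auto simp: set_compositions_def partition_on_def)
  show "finite {P. set P \<subseteq> Pow {1..n} \<and> distinct P}"
    by (rule finite_subset_distinct) simp
qed

text \<open>Hence no \<open>M_basis P\<close> vanishes. The witness is the word whose letter at
  position \<open>i\<close> is the index of the block containing \<open>i\<close>.\<close>

lemma word_composition_surj:
  assumes P: "P \<in> set_compositions n"
  shows "\<exists>w. word_composition w = P"
proof -
  have dist: "distinct P" and part: "partition_on {1..n} (set P)"
    using P by (auto simp: set_compositions_def)
  have same: "j = j'" if "j < length P" "j' < length P" "i \<in> P ! j" "i \<in> P ! j'" for i j j'
    using that dist partition_onD2[OF part] 
    by (metis disjointD disjoint_iff nth_eq_iff_index_eq nth_mem)
  have "\<forall>i\<in>{1..n}. \<exists>j. j < length P \<and> i \<in> P ! j"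
    using partition_onD1[OF part] by (metis UnionE in_set_conv_nth)
  then obtain b where b: "\<And>i. i \<in> {1..n} \<Longrightarrow> b i < length P \<and> i \<in> P ! b i"
    by metis
  \<comment> \<open>List positions start at 0 but the ground set starts at 1, hence the
    \<open>Suc\<close>.\<close>
  define w where "w = map (\<lambda>i. b (Suc i)) [0..<n]"
  have block: "{i \<in> {1..n}. b i = j} = P ! j" if "j < length P" for j
  proof -
    have "P ! j \<subseteq> {1..n}"
      using that partition_onD1[OF part] nth_mem by blast
    then show ?thesis
      using b same that by blast
  qed
  \<comment> \<open>Blocks are non-empty, so no index is skipped, and sorting the letters restores
    the order of \<open>P\<close>.\<close>
  have "set w = {..<length P}"
  proof -
    have "set w = b ` {1..n}"
      by (force simp: w_def image_iff Bex_def gr0_conv_Suc Suc_le_eq)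
    also have "\<dots> = {..<length P}"
    proof (intro set_eqI iffI)
      fix j assume "j \<in> {..<length P}"
      then have "P ! j \<noteq> {}" "P ! j = {i \<in> {1..n}. b i = j}"
        using partition_onD3[OF part] nth_mem[of j P] block[of j] by fastforce+
      then have "\<exists>i\<in>{1..n}. b i = j" by blast
      then show "j \<in> b ` {1..n}" by blast
    qed (use b in auto)
    finally show ?thesis .
  qed
  moreover have "w ! (i - 1) = b i" if "i \<in> {1..n}" for i
    using that by (cases i) (auto simp: w_def)
  moreover have "length w = n" by (simp add: w_def)
  ultimately have "word_composition w = map (\<lambda>j. {i \<in> {1..n}. b i = j}) [0..<length P]"
    by (auto simp: word_composition_def lessThan_atLeast0 intro!: Collect_cong)
  also have "\<dots> = P"
    by (rule nth_equalityI) (simp_all add: block del: atLeastAtMost_iff One_nat_def)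
  finally show ?thesis by blast
qed

lemma equiv_sc_rel: "equiv (set_compositions n) (sc_rel n)"
  by (rule equivI) (auto simp: sc_rel_def refl_on_def sym_def trans_def)

text \<open>A word whose composition lies in the class \<open>C\<close> takes the value 1 on
  \<open>N_basis C\<close> and 0 on the other generators, since classes are disjoint. These
  evaluations act as a dual basis, so the generators are independent over every field.\<close>

lemma sc_dim_eq_card: "sc_dim TYPE('k::field) n = card (set_compositions n // sc_rel n)"
proof -
  define X where "X = set_compositions n // sc_rel n"
  have X_sub: "C \<subseteq> set_compositions n" if "C \<in> X" for C
    using that equiv_sc_rel[of n] unfolding X_def by (metis Union_quotient Union_upper)
  have fin: "finite C" if "C \<in> X" for C
    using X_sub[OF that] finite_set_compositions finite_subset by blast
  have finX: "finite X"
    using X_sub finite_set_compositions[of n] by (meson Pow_iff finite_Pow_iff finite_subset subsetI)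
  have rep: "\<exists>w. \<forall>C'\<in>X. (N_basis C' :: 'k ncseries) w = (if C' = C then 1 else 0)" if "C \<in> X" for C
  proof -
    obtain P where P: "P \<in> C"
      using in_quotient_imp_non_empty[OF equiv_sc_rel] \<open>C \<in> X\<close> unfolding X_def by blast
    moreover obtain w where "word_composition w = P"
      using P X_sub[OF \<open>C \<in> X\<close>] word_composition_surj by blast
    moreover have "P \<in> C' \<longleftrightarrow> C' = C" if "C' \<in> X" for C'
      using quotient_disj[OF equiv_sc_rel, of C n C'] P that \<open>C \<in> X\<close> unfolding X_def by blast
    ultimately show ?thesis
      by (auto simp: N_basis_apply fin)
  qed
  have inj: "inj_on (N_basis :: _ \<Rightarrow> 'k ncseries) X"
  proof (rule inj_onI)
    fix C C' assume "C \<in> X" "C' \<in> X" "(N_basis C :: 'k ncseries) = N_basis C'"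
    then show "C = C'"
      using rep[of C] by (metis zero_neq_one)
  qed
  have "\<not> nc.dependent (N_basis ` X :: 'k ncseries set)"
  proof
    assume "nc.dependent (N_basis ` X :: 'k ncseries set)"
    then obtain u C where u: "(\<Sum>v\<in>N_basis ` X. ncscale (u v) v) = (0 :: 'k ncseries)"
      and C: "C \<in> X" "u (N_basis C) \<noteq> 0"
      using nc.dependent_finite[of "N_basis ` X"] finX by auto
    obtain w where w: "\<And>C'. C' \<in> X \<Longrightarrow> (N_basis C' :: 'k ncseries) w = (if C' = C then 1 else 0)"
      using rep[OF C(1)] by blast
    have eval: "(\<Sum>v\<in>S. ncscale (u v) v) w = (\<Sum>v\<in>S. u v * v w)" if "finite S" for S
      using that by induction (auto simp: ncscale_def)
    have "0 = (\<Sum>v\<in>N_basis ` X. u v * v w)"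
      using u eval[of "N_basis ` X"] finX by simp
    also have "\<dots> = (\<Sum>C'\<in>X. u (N_basis C') * N_basis C' w)"
      by (simp add: sum.reindex inj)
    also have "\<dots> = (\<Sum>C'\<in>X. if C' = C then u (N_basis C) else 0)"
      by (rule sum.cong) (auto simp: w)
    also have "\<dots> = u (N_basis C)"
      using C finX by simp
    finally show False using C by simp
  qed
  then have "nc.dim (SC n :: 'k ncseries set) = card (N_basis ` X :: 'k ncseries set)"
    unfolding SC_def X_def[symmetric] by (rule nc.dim_span_eq_card_independent)
  then show ?thesis
    using card_image[OF inj] by (simp add: sc_dim_def X_def)
qed

section \<open>Counting the classes\<close>

text \<open>A recursive substitute for \<open>card (min_part A P) = 1\<close>. It is
  \<open>False\<close> when \<open>A\<close> meets no block, where the \<open>LEAST\<close> in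
  \<open>min_part\<close> has no witness.\<close>

fun leads :: "'a set list \<Rightarrow> 'a set \<Rightarrow> bool" where
  "leads [] A \<longleftrightarrow> False"
| "leads (S # P) A \<longleftrightarrow> (if A \<inter> S \<noteq> {} then card (A \<inter> S) = 1 else leads P A)"

text \<open>A complete invariant of the class of a composition, so classes can be counted as values
  of this function.\<close>

definition lead_sets :: "'a set list \<Rightarrow> 'a set set" where
  "lead_sets P = {A. A \<subseteq> \<Union>(set P) \<and> leads P A}"

lemma min_part_Cons:
  assumes "A \<inter> \<Union>(set (S # P)) \<noteq> {}"
  shows "min_part A (S # P) = (if A \<inter> S \<noteq> {} then A \<inter> S else min_part A P)"
proof (cases "A \<inter> S = {}")
  case True
  with assms obtain S' where "S' \<in> set P" "A \<inter> S' \<noteq> {}"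
    by auto
  then obtain i where i: "i < length P" "A \<inter> P ! i \<noteq> {}"
    by (metis in_set_conv_nth)
  have "(LEAST i. i < length (S # P) \<and> A \<inter> (S # P) ! i \<noteq> {}) =
        Suc (LEAST i. Suc i < length (S # P) \<and> A \<inter> (S # P) ! Suc i \<noteq> {})"
    by (rule Least_Suc[of _ "Suc i"]) (use i True in auto)
  with True show ?thesis by (simp add: min_part_def)
next
  case False
  have "(LEAST i. i < length (S # P) \<and> A \<inter> (S # P) ! i \<noteq> {}) = 0"
    by (rule Least_eq_0) (use False in auto)
  with False show ?thesis by (simp add: min_part_def)
qed

lemma leads_iff_card_min_part:
  "A \<inter> \<Union>(set P) \<noteq> {} \<Longrightarrow> leads P A \<longleftrightarrow> card (min_part A P) = 1"
proof (induction P)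
  case (Cons S P)
  then show ?case by (cases "A \<inter> S = {}") (auto simp: min_part_Cons)
qed simp

lemma leads_disjoint: "A \<inter> \<Union>(set P) = {} \<Longrightarrow> \<not> leads P A"
  by (induction P) auto

text \<open>The ground set is arbitrary because the recursion passes from \<open>V\<close> to its
  subsets.\<close>

definition compositions :: "'a set \<Rightarrow> 'a set list set" where
  "compositions V = {P. distinct P \<and> partition_on V (set P)}"

lemma card_image_quotient:
  assumes "\<And>x y. x \<in> S \<Longrightarrow> y \<in> S \<Longrightarrow> (x, y) \<in> r \<longleftrightarrow> f x = f y" "equiv S r"
  shows "card (S // r) = card (f ` S)"
proof -
  have "bij_betw (\<lambda>y. {x \<in> S. f x = y}) (f ` S) (S // r)"
  proof (rule bij_betw_imageI)
    show "inj_on (\<lambda>y. {x \<in> S. f x = y}) (f ` S)"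
      by (rule inj_onI) blast
    have "r `` {x} = {z \<in> S. f z = f x}" if "x \<in> S" for x
      using assms that unfolding equiv_def refl_on_def by fastforce
    then show "(\<lambda>y. {x \<in> S. f x = y}) ` f ` S = S // r"
      by (auto simp: quotient_def image_iff)
  qed
  then show ?thesis by (simp add: bij_betw_same_card)
qed

lemma card_sc_classes: "card (set_compositions n // sc_rel n) = card (lead_sets ` compositions {1..n})"
proof -
  have "set_compositions n = compositions {1..n}"
    by (simp add: set_compositions_def compositions_def)
  moreover have "(P, Q) \<in> sc_rel n \<longleftrightarrow> lead_sets P = lead_sets Q"
    if "P \<in> set_compositions n" "Q \<in> set_compositions n" for P Q
  proof -
    have un: "\<Union>(set P) = {1..n}" "\<Union>(set Q) = {1..n}"
      using that by (auto simp: set_compositions_def partition_on_def)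
    have "lead_sets P = lead_sets Q \<longleftrightarrow> (\<forall>A\<subseteq>{1..n}. leads P A \<longleftrightarrow> leads Q A)"
      unfolding lead_sets_def un by blast
    \<comment> \<open>The empty set cannot separate two lists: \<open>leads\<close> is
      \<open>False\<close> on it.\<close>
    also have "\<dots> \<longleftrightarrow> (\<forall>A. A \<subseteq> {1..n} \<and> A \<noteq> {} \<longrightarrow> (leads P A \<longleftrightarrow> leads Q A))"
      using leads_disjoint[of "{}"] by auto
    also have "\<dots> \<longleftrightarrow> (P, Q) \<in> sc_rel n"
    proof -
      have "leads P A \<longleftrightarrow> card (min_part A P) = 1" "leads Q A \<longleftrightarrow> card (min_part A Q) = 1"
        if "A \<subseteq> {1..n}" "A \<noteq> {}" for A
        using that un by (intro leads_iff_card_min_part; blast)+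
      then show ?thesis using that by (auto simp: sc_rel_def)
    qed
    finally show ?thesis by blast
  qed
  ultimately show ?thesis
    using card_image_quotient[OF _ equiv_sc_rel] by metis
qed

section \<open>Splitting a composition after its initial run of singletons\<close>

lemma compositions_Nil [simp]: "[] \<in> compositions V \<longleftrightarrow> V = {}"
  by (auto simp: compositions_def partition_on_def)

lemma compositions_Cons [simp]:
  "S # P \<in> compositions V \<longleftrightarrow> S \<noteq> {} \<and> S \<subseteq> V \<and> P \<in> compositions (V - S)"
proof (cases "disjnt S (\<Union>(set P))")
  case True
  then have "S \<noteq> {} \<Longrightarrow> S \<notin> set P"
    by (auto simp: disjnt_def)
  with partition_on_insert[OF True] show ?thesis
    by (auto simp: compositions_def)
next
  case False
  then show ?thesis
    by (auto simp: compositions_def partition_on_def disjnt_def disjoint_def)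
qed

lemma Union_composition: "P \<in> compositions V \<Longrightarrow> \<Union>(set P) = V"
  by (auto simp: compositions_def partition_on_def)

lemma compositions_append:
  "P @ Q \<in> compositions V \<longleftrightarrow>
     \<Union>(set P) \<subseteq> V \<and> P \<in> compositions (\<Union>(set P)) \<and> Q \<in> compositions (V - \<Union>(set P))"
proof (induction P arbitrary: V)
  case (Cons S P)
  have "P \<in> compositions (S \<union> \<Union>(set P) - S) \<longleftrightarrow> S \<inter> \<Union>(set P) = {} \<and> P \<in> compositions (\<Union>(set P))"
  proof (cases "S \<inter> \<Union>(set P) = {}")
    case True
    then have "S \<union> \<Union>(set P) - S = \<Union>(set P)" by blast
    with True show ?thesis by simp
  next
    case False
    then show ?thesis using Union_composition[of P "S \<union> \<Union>(set P) - S"] by blast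
  qed
  moreover have "V - S - \<Union>(set P) = V - \<Union>(set (S # P))" by auto
  ultimately show ?case
    using Cons.IH[of "V - S"] by auto
qed simp

text \<open>A set that meets a singleton meets it in one point. The order within the run is thus
  invisible, which is how different compositions become equivalent.\<close>

lemma leads_append_singletons:
  "(\<And>S. S \<in> set P \<Longrightarrow> card S = 1) \<Longrightarrow> leads (P @ Q) A \<longleftrightarrow> A \<inter> \<Union>(set P) \<noteq> {} \<or> leads Q A"
proof (induction P)
  case (Cons S P)
  from Cons.prems[of S] obtain x where "S = {x}"
    by (auto simp: card_1_singleton_iff)
  with Cons show ?case by auto
qed simp

text \<open>
  \<open>peel V (R, B) T\<close> is the family \<open>lead_sets\<close> of a composition of \<open>V\<close> that begins with the elements of
  \<open>R\<close> as singletons, in any order, continues with the block \<open>B\<close>, and has \<open>T\<close> as the family of the rest.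
\<close>

definition peel :: "'a set \<Rightarrow> 'a set \<times> 'a set \<Rightarrow> 'a set set \<Rightarrow> 'a set set" where
  "peel V = (\<lambda>(R, B) T. {A. A \<subseteq> V \<and> (A \<inter> R \<noteq> {} \<or> card (A \<inter> B) = 1 \<or> A \<in> T)})"

text \<open>The bound 2 keeps the block out of the run before it, so a composition of a finite set
  that has a larger block has exactly one head.\<close>

definition heads :: "'a set \<Rightarrow> ('a set \<times> 'a set) set" where
  "heads V = (SIGMA R:Pow V. {B. B \<subseteq> V - R \<and> 2 \<le> card B})"

lemma lead_sets_singletons:
  assumes "\<And>S. S \<in> set P \<Longrightarrow> card S = 1"
  shows "lead_sets P = Pow (\<Union>(set P)) - {{}}"
  using leads_append_singletons[OF assms, of P "[]"] by (auto simp: lead_sets_def)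

text \<open>Members of \<open>lead_sets Q\<close> avoid both the run and \<open>B\<close>, so the
  nested case distinction of \<open>leads\<close> becomes a plain disjunction.\<close>

lemma lead_sets_peel:
  assumes "\<And>S. S \<in> set P \<Longrightarrow> card S = 1" and comp: "P @ B # Q \<in> compositions V"
  shows "lead_sets (P @ B # Q) = peel V (\<Union>(set P), B) (lead_sets Q)"
proof -
  define R where "R = \<Union>(set P)"
  have un: "R \<subseteq> V" "B \<subseteq> V - R" "\<Union>(set Q) = V - R - B"
    using comp Union_composition by (auto simp: compositions_append R_def)
  have "leads (P @ B # Q) A \<longleftrightarrow> A \<inter> R \<noteq> {} \<or> card (A \<inter> B) = 1 \<or> A \<in> lead_sets Q"
    if "A \<subseteq> V" for A
  proof -
    have "A \<in> lead_sets Q \<longleftrightarrow> A \<inter> R = {} \<and> A \<inter> B = {} \<and> leads Q A"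
      using that un(3) unfolding lead_sets_def by blast
    moreover have "leads (P @ B # Q) A \<longleftrightarrow> A \<inter> R \<noteq> {} \<or> leads (B # Q) A"
      using leads_append_singletons[OF assms(1), of P "B # Q" A] unfolding R_def by blast
    ultimately show ?thesis by (cases "A \<inter> B = {}") auto
  qed
  moreover have "\<Union>(set (P @ B # Q)) = V"
    using comp by (rule Union_composition)
  ultimately show ?thesis
    unfolding peel_def R_def[symmetric] lead_sets_def[of "P @ B # Q"] prod.case by blast
qed

lemma singletons_composition:
  fixes R :: "'a set"
  assumes "finite R"
  obtains P where "P \<in> compositions R" "\<And>S. S \<in> set P \<Longrightarrow> card S = 1"
  using assms
proof (induction R arbitrary: thesis rule: finite_induct)
  case empty
  show ?case by (rule empty[of "[]"]) auto
next
  case (insert x R)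
  obtain P where P: "P \<in> compositions R" "\<And>S. S \<in> set P \<Longrightarrow> card S = 1"
    using insert.IH by blast
  show ?case
    by (rule insert.prems[of "{x} # P"]) (use P insert.hyps in auto)
qed

text \<open>Cut at the first block that is not a singleton. If there is none, every non-empty subset
  leads; otherwise the cut yields a head and a composition of the rest. Conversely, any head is
  realised by listing its run in some order.\<close>

lemma lead_sets_compositions:
  fixes V :: "'a set"
  assumes "finite V"
  shows "lead_sets ` compositions V = insert (Pow V - {{}})
    ((\<lambda>(h, T). peel V h T) `
      (SIGMA h:heads V. lead_sets ` compositions (V - fst h - snd h)))" (is "?L = insert _ ?R")
proof (intro equalityI subsetI)
  fix T assume "T \<in> ?L"
  then obtain P where P: "P \<in> compositions V" and T: "T = lead_sets P" by blast
  define X Y where "X = takeWhile (\<lambda>S. card S = 1) P" and "Y = dropWhile (\<lambda>S. card S = 1) P"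
  have XY: "P = X @ Y" and X: "\<And>S. S \<in> set X \<Longrightarrow> card S = 1"
    by (auto simp: X_def Y_def dest: set_takeWhileD)
  show "T \<in> insert (Pow V - {{}}) ?R"
  proof (cases Y)
    case Nil
    then have "T = Pow V - {{}}"
      using lead_sets_singletons[OF X, of X] XY T Union_composition[OF P] by simp
    then show ?thesis by simp
  next
    case (Cons B Q)
    have "card B \<noteq> 1"
      using Cons by (auto simp: Y_def dest!: dropWhile_eq_Cons_conv[THEN iffD1])
    have comp: "X @ B # Q \<in> compositions V" using P XY Cons by simp
    then have props: "\<Union>(set X) \<subseteq> V" "B \<noteq> {}" "B \<subseteq> V - \<Union>(set X)" "Q \<in> compositions (V - \<Union>(set X) - B)"
      by (auto simp: compositions_append)
    \<comment> \<open>\<open>card\<close> is 0 on infinite sets as well, so finiteness of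
      \<open>V\<close> enters here.\<close>
    then have "card B \<noteq> 0"
      using assms finite_subset by (metis card_eq_0_iff finite_Diff)
    with \<open>card B \<noteq> 1\<close> have "(\<Union>(set X), B) \<in> heads V"
      using props by (auto simp: heads_def)
    moreover have "T = peel V (\<Union>(set X), B) (lead_sets Q)"
      using lead_sets_peel[OF X comp] T XY Cons by simp
    ultimately have "T \<in> ?R"
      using props(4) by (intro image_eqI[of _ _ "((\<Union>(set X), B), lead_sets Q)"]) auto
    then show ?thesis by blast
  qed
next
  fix T assume "T \<in> insert (Pow V - {{}}) ?R"
  then consider "T = Pow V - {{}}" | R B Q where "(R, B) \<in> heads V"
    "Q \<in> compositions (V - R - B)" "T = peel V (R, B) (lead_sets Q)"
    by auto
  then show "T \<in> ?L"
  proof cases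
    case 1
    obtain P where "P \<in> compositions V" "\<And>S. S \<in> set P \<Longrightarrow> card S = 1"
      using singletons_composition[OF assms] by blast
    then show ?thesis
      using lead_sets_singletons[of P] Union_composition[of P V] 1 by (metis imageI)
  next
    case 2
    then have R: "R \<subseteq> V" and B: "B \<subseteq> V - R" "B \<noteq> {}" by (auto simp: heads_def)
    obtain P where P: "P \<in> compositions R" "\<And>S. S \<in> set P \<Longrightarrow> card S = 1"
      using singletons_composition R assms finite_subset by metis
    have "\<Union>(set P) = R" using P(1) by (rule Union_composition)
    moreover from this have "P @ B # Q \<in> compositions V"
      using P(1) R B 2 by (simp add: compositions_append)
    ultimately show ?thesis
      using lead_sets_peel[OF P(2), of P B Q V] 2 by (metis imageI)
  qed
qed

section \<open>Recovering the head and the rest from a family\<close>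

lemma mem_peel: "A \<in> peel V (R, B) T \<longleftrightarrow> A \<subseteq> V \<and> (A \<inter> R \<noteq> {} \<or> card (A \<inter> B) = 1 \<or> A \<in> T)"
  by (simp add: peel_def)

lemma headsD:
  assumes "(R, B) \<in> heads V"
  shows "R \<subseteq> V" "B \<subseteq> V - R" "2 \<le> card B" "B \<noteq> {}"
  using assms by (auto simp: heads_def)

text \<open>Such a set meets \<open>B\<close> in at least two points and is too large for
  \<open>T\<close>. These non-members are what tells families apart.\<close>

lemma peel_disjoint_head:
  assumes "(R, B) \<in> heads V" "T \<subseteq> Pow (V - R - B)" "B \<subseteq> A" "A \<inter> R = {}"
  shows "A \<notin> peel V (R, B) T"
proof -
  have "A \<inter> B = B" using assms(3) by blast
  moreover have "A \<notin> T" using headsD(4)[OF assms(1)] assms(2,3) by blast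
  ultimately show ?thesis using headsD(3)[OF assms(1)] assms(4) by (simp add: mem_peel)
qed

text \<open>The block \<open>B\<close> itself is missing on the left. The all-singletons family is
  therefore counted separately.\<close>

lemma peel_ne_Pow:
  assumes "(R, B) \<in> heads V" "T \<subseteq> Pow (V - R - B)"
  shows "peel V (R, B) T \<noteq> Pow V - {{}}"
proof -
  note h = headsD[OF assms(1)]
  have "B \<notin> peel V (R, B) T"
    using assms h by (intro peel_disjoint_head) auto
  moreover have "B \<in> Pow V - {{}}" using h by auto
  ultimately show ?thesis by metis
qed

text \<open>
  A family \<open>peel V (R, B) T\<close> determines \<open>R\<close> as the elements all of whose supersets it contains, then
  \<open>B\<close> from the pairs none of whose supersets disjoint from \<open>R\<close> it contains.
\<close>

lemma peel_eq_imp_singletons_subset: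
  assumes "(R, B) \<in> heads V" "(R', B') \<in> heads V"
    "T' \<subseteq> Pow (V - R' - B')" "peel V (R, B) T = peel V (R', B') T'"
  shows "R \<subseteq> R'"
proof
  fix a assume a: "a \<in> R"
  show "a \<in> R'"
  proof (rule ccontr)
    assume "a \<notin> R'"
    \<comment> \<open>This set contains \<open>B'\<close> and misses \<open>R'\<close>, yet it meets
      \<open>R\<close> in \<open>a\<close>, so it separates the two families.\<close>
    then have "insert a B' \<notin> peel V (R', B') T'"
      using headsD[OF assms(2)] assms(2,3) by (intro peel_disjoint_head) auto
    moreover have "insert a B' \<in> peel V (R, B) T"
      using headsD(1)[OF assms(1)] headsD(2)[OF assms(2)] a by (auto simp: mem_peel)
    ultimately show False using assms(4) by metis
  qed
qed

lemma peel_eq_imp_block_subset: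
  assumes "finite V" "(R, B) \<in> heads V" "(R, B') \<in> heads V"
    "T \<subseteq> Pow (V - R - B)" "peel V (R, B) T = peel V (R, B') T'"
  shows "B \<subseteq> B'"
proof
  fix a assume a: "a \<in> B"
  show "a \<in> B'"
  proof (rule ccontr)
    assume "a \<notin> B'"
    have B: "B \<subseteq> V - R" "2 \<le> card B" "finite B" and B': "B' \<subseteq> V - R" "2 \<le> card B'" "finite B'"
      using headsD[OF assms(2)] headsD[OF assms(3)] assms(1) by (auto intro: finite_subset)
    have "\<not> B \<subseteq> {a}" using B(2) card_mono[of "{a}" B] by auto
    then obtain b where b: "b \<in> B" "b \<noteq> a" by blast
    have "B' \<noteq> {}" using B'(2) by auto
    \<comment> \<open>Choosing \<open>c = b\<close> when \<open>b\<close> lies in \<open>B'\<close>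
      makes \<open>{a, b, c}\<close> meet \<open>B'\<close> in one point while it still contains two
      points of \<open>B\<close>.\<close>
    then obtain c where c: "c \<in> B'" "b \<in> B' \<Longrightarrow> c = b" by blast
    define A where "A = {a, b, c}"
    have "A \<inter> B' = {c}" using \<open>a \<notin> B'\<close> c by (auto simp: A_def)
    then have "A \<in> peel V (R, B') T'"
      using a b c B B' by (auto simp: mem_peel A_def)
    moreover have "A \<notin> peel V (R, B) T"
    proof -
      have "card {a, b} \<le> card (A \<inter> B)"
        by (rule card_mono) (use a b B in \<open>auto simp: A_def\<close>)
      then have "card (A \<inter> B) \<noteq> 1" using b by auto
      moreover have "A \<inter> R = {}" using a b c B B' by (auto simp: A_def)
      moreover have "A \<notin> T" using a assms(4) by (auto simp: A_def)
      ultimately show ?thesis by (simp add: mem_peel)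
    qed
    ultimately show False using assms(5) by metis
  qed
qed

text \<open>The members of the family that avoid \<open>R\<close> and \<open>B\<close> can only come
  from the rest.\<close>

lemma peel_eq_imp_rest_subset:
  assumes "T \<subseteq> Pow (V - R - B)" "peel V (R, B) T = peel V (R, B) T'"
  shows "T \<subseteq> T'"
proof
  fix A assume A: "A \<in> T"
  with assms(1) have "A \<subseteq> V" "A \<inter> R = {}" "A \<inter> B = {}" by auto
  moreover from this A have "A \<in> peel V (R, B) T" by (simp add: mem_peel)
  ultimately show "A \<in> T'" unfolding assms(2) by (simp add: mem_peel)
qed

text \<open>The run, the block and the rest are recovered in this order, each using the equalities
  already obtained.\<close>

lemma inj_on_peel:
  assumes "finite V" and sub: "\<And>h T. T \<in> \<T> h \<Longrightarrow> T \<subseteq> Pow (V - fst h - snd h)"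
  shows "inj_on (\<lambda>(h, T). peel V h T) (SIGMA h:heads V. \<T> h)"
proof (rule inj_onI, clarsimp)
  fix R B T R' B' T'
  assume h: "(R, B) \<in> heads V" "(R', B') \<in> heads V"
    and T: "T \<in> \<T> (R, B)" "T' \<in> \<T> (R', B')" and eq: "peel V (R, B) T = peel V (R', B') T'"
  note sub = sub[OF T(1), simplified] sub[OF T(2), simplified]
  have R: "R = R'"
    using peel_eq_imp_singletons_subset[OF h sub(2) eq]
      peel_eq_imp_singletons_subset[OF h(2,1) sub(1) eq[symmetric]] by (rule equalityI)
  note h = h[folded R] and sub = sub[folded R] and eq = eq[folded R]
  have B: "B = B'"
    using peel_eq_imp_block_subset[OF assms(1) h sub(1) eq]
      peel_eq_imp_block_subset[OF assms(1) h(2,1) sub(2) eq[symmetric]] by (rule equalityI)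
  note sub = sub[folded B] and eq = eq[folded B]
  have "T = T'"
    using peel_eq_imp_rest_subset[OF sub(1) eq] peel_eq_imp_rest_subset[OF sub(2) eq[symmetric]]
    by (rule equalityI)
  with R B show "R = R' \<and> B = B' \<and> T = T'" by simp
qed

section \<open>The recursion for the number of families\<close>

lemma finite_lead_sets_compositions:
  fixes V :: "'a set"
  shows "finite V \<Longrightarrow> finite (lead_sets ` compositions V)"
  by (rule finite_subset[of _ "Pow (Pow V)"]) (auto simp: lead_sets_def dest!: Union_composition)

lemma finite_heads: "finite V \<Longrightarrow> finite (heads V)"
  by (rule finite_subset[of _ "Pow V \<times> Pow V"]) (auto simp: heads_def)

text \<open>The summand 1 is the all-singletons family; the remaining families correspond
  bijectively to a head together with a family of the rest.\<close>

lemma card_lead_sets_compositions: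
  fixes V :: "'a set"
  assumes "finite V"
  shows "card (lead_sets ` compositions V) =
    1 + (\<Sum>R\<in>Pow V. \<Sum>B | B \<subseteq> V - R \<and> 2 \<le> card B. card (lead_sets ` compositions (V - R - B)))"
proof -
  define \<T> where "\<T> = (\<lambda>h. lead_sets ` compositions (V - fst h - snd h))"
  have sub: "T \<subseteq> Pow (V - fst h - snd h)" if "T \<in> \<T> h" for h T
    using that by (auto simp: \<T>_def lead_sets_def dest!: Union_composition)
  have fin: "finite (\<T> h)" for h
    using assms by (simp add: \<T>_def finite_lead_sets_compositions)
  have "Pow V - {{}} \<notin> (\<lambda>(h, T). peel V h T) ` (SIGMA h:heads V. \<T> h)"
  proof
    assume "Pow V - {{}} \<in> (\<lambda>(h, T). peel V h T) ` (SIGMA h:heads V. \<T> h)"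
    then obtain R B T where "(R, B) \<in> heads V" "T \<in> \<T> (R, B)" "Pow V - {{}} = peel V (R, B) T"
      by auto
    with peel_ne_Pow sub[of T "(R, B)"] show False by (metis fst_conv snd_conv)
  qed
  moreover have "lead_sets ` compositions V =
      insert (Pow V - {{}}) ((\<lambda>(h, T). peel V h T) ` (SIGMA h:heads V. \<T> h))"
    using lead_sets_compositions[OF assms] by (simp add: \<T>_def)
  ultimately have "card (lead_sets ` compositions V) =
      1 + card ((\<lambda>(h, T). peel V h T) ` (SIGMA h:heads V. \<T> h))"
    using finite_heads[OF assms] fin by simp
  also have "\<dots> = 1 + (\<Sum>h\<in>heads V. card (\<T> h))"
    using inj_on_peel[OF assms, of \<T>] sub finite_heads[OF assms] fin by (simp add: card_image)
  also have "(\<Sum>h\<in>heads V. card (\<T> h)) =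
      (\<Sum>R\<in>Pow V. \<Sum>B | B \<subseteq> V - R \<and> 2 \<le> card B. card (\<T> (R, B)))"
    unfolding heads_def by (subst sum.Sigma) (use assms in auto)
  finally show ?thesis by (simp add: \<T>_def)
qed

section \<open>From the recursion to the exponential generating function\<close>

lemma sum_Pow_card:
  assumes "finite V"
  shows "(\<Sum>R\<in>Pow V. h (card R)) = (\<Sum>r\<le>card V. of_nat (card V choose r) * (h r :: 'b::comm_semiring_1))"
proof -
  have "(\<Sum>R\<in>Pow V. h (card R)) = (\<Sum>r\<le>card V. \<Sum>R | R \<in> Pow V \<and> card R = r. h (card R))"
    by (rule sum.group[symmetric]) (use assms in \<open>auto intro: card_mono\<close>)
  also have "\<dots> = (\<Sum>r\<le>card V. of_nat (card V choose r) * h r)"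
  proof (rule sum.cong)
    fix r
    have "(\<Sum>R | R \<in> Pow V \<and> card R = r. h (card R)) = (\<Sum>R | R \<subseteq> V \<and> card R = r. h r)"
      by (rule sum.cong) auto
    then show "(\<Sum>R | R \<in> Pow V \<and> card R = r. h (card R)) = of_nat (card V choose r) * h r"
      using n_subsets[OF assms] by simp
  qed simp
  finally show ?thesis .
qed

text \<open>The formal \<open>1 / (1 - g)\<close> with \<open>g = exp x - exp (- x) - x\<close>. The
  constant term of the denominator is 1, so this is a true inverse.\<close>

definition sc_fps :: "'a::field_char_0 fps" where
  "sc_fps = inverse (1 + fps_X + fps_exp (- 1) - fps_exp 1)"

text \<open>Multiply the defining equation by \<open>exp x\<close> and cancel
  \<open>exp x * exp (- x)\<close>. The outer exponential accounts for the run,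
  \<open>exp x - 1 - x\<close> for a block of size at least 2, and the 1 for a composition that ends
  with the run.\<close>

lemma sc_fps_eq:
  "sc_fps = fps_exp 1 * (1 + (fps_exp 1 - 1 - fps_X) * (sc_fps :: 'a::field_char_0 fps))"
proof -
  define D :: "'a fps" where "D = 1 + fps_X + fps_exp (- 1) - fps_exp 1"
  have "D * sc_fps = 1"
    unfolding sc_fps_def D_def by (rule inverse_mult_eq_1') simp
  moreover have "fps_exp 1 * D = fps_exp 1 + fps_exp 1 * fps_X + 1 - fps_exp 1 * fps_exp (1::'a)"
    using fps_exp_add_mult[of 1 "-1::'a"] by (simp add: D_def algebra_simps)
  ultimately have "fps_exp 1 = (fps_exp 1 + fps_exp 1 * fps_X + 1 - fps_exp 1 * fps_exp (1::'a)) * sc_fps"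
    by (metis mult.assoc mult.right_neutral)
  then show ?thesis by (simp add: algebra_simps)
qed

lemma fact_fps_exp_mult_nth:
  "fact n * (fps_exp 1 * G) $ n = (\<Sum>r\<le>n. of_nat (n choose r) * (fact (n - r) * (G $ (n - r) :: 'a::field_char_0)))"
  unfolding fps_mult_nth sum_distrib_left atLeast0AtMost
  by (rule sum.cong) (auto simp: binomial_fact field_simps)

lemma fact_big_block_mult_nth:
  "fact m * ((fps_exp 1 - 1 - fps_X) * G) $ m =
     (\<Sum>b\<le>m. of_nat (m choose b) * (if 2 \<le> b then fact (m - b) * (G $ (m - b) :: 'a::field_char_0) else 0))"
  unfolding fps_mult_nth sum_distrib_left atLeast0AtMost
  by (rule sum.cong) (auto simp: binomial_fact field_simps not_le less_2_cases_iff fps_X_def)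

lemma card_lead_sets_eq_fact_fps:
  fixes V :: "'a set"
  assumes "finite V"
  shows "of_nat (card (lead_sets ` compositions V)) = fact (card V) * (sc_fps $ card V :: 'b::field_char_0)"
  using assms
proof (induction "card V" arbitrary: V rule: less_induct)
  case less
  let ?f = "\<lambda>n. fact n * (sc_fps $ n :: 'b)"
  let ?G = "1 + (fps_exp 1 - 1 - fps_X) * (sc_fps :: 'b fps)"
  \<comment> \<open>The number of ways to continue with a larger block and a rest when
    \<open>m\<close> elements remain after the run.\<close>
  define k where "k m = (\<Sum>b\<le>m. of_nat (m choose b) * (if 2 \<le> b then ?f (m - b) else 0))" for m
  have inner: "(\<Sum>B | B \<subseteq> V - R \<and> 2 \<le> card B. of_nat (card (lead_sets ` compositions (V - R - B)))) =
      k (card V - card R)" if "R \<in> Pow V" for R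
  proof -
    have fin: "finite R" "finite (V - R)" using that less finite_subset by auto
    have cVR: "card (V - R) = card V - card R" using that fin by (simp add: card_Diff_subset)
    have "(\<Sum>B | B \<subseteq> V - R \<and> 2 \<le> card B. of_nat (card (lead_sets ` compositions (V - R - B)))) =
        (\<Sum>B | B \<subseteq> V - R \<and> 2 \<le> card B. ?f (card (V - R) - card B))"
    proof (rule sum.cong)
      fix B assume "B \<in> {B. B \<subseteq> V - R \<and> 2 \<le> card B}"
      then have B: "B \<subseteq> V - R" "2 \<le> card B" "finite B" using fin finite_subset by auto
      have "card B \<le> card (V - R)" using B fin by (simp add: card_mono)
      moreover have "card (V - R - B) = card (V - R) - card B"
        using B by (simp add: card_Diff_subset)
      ultimately show "of_nat (card (lead_sets ` compositions (V - R - B))) = ?f (card (V - R) - card B)"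
        using less.hyps[of "V - R - B"] fin B cVR by simp
    qed simp
    also have "\<dots> = (\<Sum>B\<in>Pow (V - R). if 2 \<le> card B then ?f (card (V - R) - card B) else 0)"
      using fin by (subst sum.If_cases) (auto intro!: sum.cong)
    also have "\<dots> = k (card (V - R))"
      unfolding k_def by (rule sum_Pow_card[OF fin(2)])
    finally show ?thesis unfolding cVR .
  qed
  have kG: "(if m = 0 then 1 else 0) + k m = fact m * ?G $ m" for m
    using fact_big_block_mult_nth[of m "sc_fps :: 'b fps"] by (simp add: k_def algebra_simps)
  have "of_nat (card (lead_sets ` compositions V)) = (1 :: 'b) + (\<Sum>R\<in>Pow V. k (card V - card R))"
    by (subst card_lead_sets_compositions) (use less inner in auto)
  also have "\<dots> = 1 + (\<Sum>r\<le>card V. of_nat (card V choose r) * k (card V - r))"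
    using sum_Pow_card[OF less.prems, of "\<lambda>r. k (card V - r)"] by simp
  \<comment> \<open>The isolated 1 becomes part of the term \<open>r = card V\<close>, where the run
    exhausts \<open>V\<close>; it supplies the constant term of \<open>?G\<close>.\<close>
  also have "\<dots> = (\<Sum>r\<le>card V. of_nat (card V choose r) * ((if card V - r = 0 then 1 else 0) + k (card V - r)))"
  proof -
    have "(\<Sum>r\<le>card V. of_nat (card V choose r) * (if card V - r = 0 then 1 else 0)) =
      (\<Sum>r\<le>card V. if r = card V then 1 else (0::'b))"
      by (rule sum.cong) auto
    then show ?thesis by (simp add: distrib_left sum.distrib)
  qed
  also have "\<dots> = fact (card V) * (fps_exp 1 * ?G) $ card V"
    unfolding kG by (rule fact_fps_exp_mult_nth[symmetric])
  also have "\<dots> = ?f (card V)"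
    using sc_fps_eq[where ?'a = 'b] by simp
  finally show ?case .
qed

lemma sc_dim_eq_fact_fps: "of_nat (sc_dim TYPE('k::field) n) = fact n * (sc_fps $ n :: 'a::field_char_0)"
  using card_lead_sets_eq_fact_fps[of "{1..n}"] by (simp add: sc_dim_eq_card card_sc_classes)

section \<open>The generating function\<close>

lemma sc_egf_eq: "sc_egf z = inverse (1 + z + exp (- z) - exp z)"
proof -
  have "1 + (1 + z) * exp z - exp (2 * z) = exp z * (1 + z + exp (- z) - exp z)"
    by (simp add: algebra_simps flip: exp_add)
  then show ?thesis by (simp add: sc_egf_def inverse_eq_divide)
qed

lemma has_fps_expansion_sc_egf: "sc_egf has_fps_expansion sc_fps"
proof -
  have "(\<lambda>z. inverse (1 + z + exp (- 1 * z) - exp (1 * z) :: complex)) has_fps_expansion sc_fps"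
    unfolding sc_fps_def
    by (intro has_fps_expansion_inverse has_fps_expansion_add has_fps_expansion_diff
        has_fps_expansion_1 has_fps_expansion_fps_X has_fps_expansion_exp) simp
  then show ?thesis by (simp add: sc_egf_eq[abs_def])
qed

text \<open>The power series of \<open>e\<^sup>z - e\<^sup>-\<^sup>z - 2z\<close> has non-negative coefficients.\<close>

lemma norm_sinh_tail_le:
  fixes z :: complex
  shows "norm (exp z - exp (- z) - 2 * z) \<le> exp (norm z) - exp (- norm z) - 2 * norm z"
proof (rule norm_sums_le)
  have sums: "(\<lambda>n::nat. z ^ n /\<^sub>R fact n - (- z) ^ n /\<^sub>R fact n - (if n = 1 then 2 * z else 0)) sums
      (exp z - exp (- z) - 2 * z)" for z :: "'b::{real_normed_field,banach}"
    by (intro sums_diff exp_converges sums_single)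
  show "(\<lambda>n::nat. z ^ n /\<^sub>R fact n - (- z) ^ n /\<^sub>R fact n - (if n = 1 then 2 * z else 0)) sums
      (exp z - exp (- z) - 2 * z)"
    by (rule sums)
  show "(\<lambda>n::nat. norm z ^ n /\<^sub>R fact n - (- norm z) ^ n /\<^sub>R fact n - (if n = 1 then 2 * norm z else 0)) sums
      (exp (norm z) - exp (- norm z) - 2 * norm z)"
    by (rule sums)
  fix n :: nat
  \<comment> \<open>Even terms cancel, the linear term is removed by \<open>2 * z\<close>, and every
    other odd term is doubled.\<close>
  consider "even n" | "n = 1" | "odd n" "n \<noteq> 1" by blast
  then show "norm (z ^ n /\<^sub>R fact n - (- z) ^ n /\<^sub>R fact n - (if n = 1 then 2 * z else 0)) \<le>
      norm z ^ n /\<^sub>R fact n - (- norm z) ^ n /\<^sub>R fact n - (if n = 1 then 2 * norm z else 0)"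
  proof cases
    case 3
    then have "z ^ n /\<^sub>R fact n - (- z) ^ n /\<^sub>R fact n = z ^ n /\<^sub>R fact n + z ^ n /\<^sub>R fact n"
      by simp
    moreover have "norm (z ^ n /\<^sub>R fact n + z ^ n /\<^sub>R fact n) \<le> norm z ^ n /\<^sub>R fact n + norm z ^ n /\<^sub>R fact n"
      by (rule norm_triangle_le) (simp add: norm_power)
    ultimately show ?thesis using 3 by simp
  qed auto
qed

text \<open>One of \<open>exp t\<close> and \<open>exp (- t)\<close> is at least 1 and the other is
  positive, so the derivative is positive on the whole line. This makes the real root
  unique.\<close>

lemma strict_mono_sinh_diff: "strict_mono (\<lambda>x::real. exp x - exp (- x) - x)"
proof (rule strict_monoI)
  fix x y :: real assume "x < y"
  then show "exp x - exp (- x) - x < exp y - exp (- y) - y"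
  proof (rule DERIV_pos_imp_increasing)
    fix t :: real
    have "1 < exp t + exp (- t)"
    proof (cases "t \<ge> 0")
      case True
      then have "1 \<le> exp t" by simp
      with exp_gt_zero[of "- t"] show ?thesis by linarith
    next
      case False
      then have "1 \<le> exp (- t)" by simp
      with exp_gt_zero[of t] show ?thesis by linarith
    qed
    then show "\<exists>d. ((\<lambda>x. exp x - exp (- x) - x) has_real_derivative d) (at t) \<and> 0 < d"
      by (intro exI[of _ "exp t + exp (- t) - 1"]) (auto intro!: derivative_eq_intros)
  qed
qed

text \<open>
  With \<open>r = \<bar>z\<bar>\<close>, comparing real parts gives \<open>1 - Re z \<le> e\<^sup>r - e\<^sup>-\<^sup>r - 2r \<le> 1 - r\<close>, so \<open>z = r\<close>.
\<close>

lemma sc_root_unique_in_cball: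
  fixes z :: complex and \<gamma> :: real
  assumes root: "exp \<gamma> - exp (- \<gamma>) - \<gamma> = 1" and z: "exp z - exp (- z) - z = 1" "norm z \<le> \<gamma>"
  shows "z = of_real \<gamma>"
proof -
  let ?r = "norm z"
  have "exp ?r - exp (- ?r) - ?r \<le> 1"
    using strict_mono_sinh_diff z(2) root by (metis (mono_tags, lifting) strict_mono_less_eq)
  moreover have "1 - Re z = Re (exp z - exp (- z) - 2 * z)"
    using arg_cong[OF z(1), of Re] by simp
  moreover have "\<dots> \<le> exp ?r - exp (- ?r) - 2 * ?r"
    using complex_Re_le_cmod norm_sinh_tail_le order_trans by blast
  ultimately have "Re z = ?r"
    using complex_Re_le_cmod[of z] by linarith
  moreover from this have "Im z = 0"
    using cmod_power2[of z] by simp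
  ultimately have zr: "z = of_real ?r"
    by (simp add: complex_eq_iff)
  have "complex_of_real (exp ?r - exp (- ?r) - ?r) = of_real 1"
    using z(1) by (subst (asm) (1 2 3) zr) (simp add: exp_of_real flip: of_real_minus)
  then have "exp ?r - exp (- ?r) - ?r = exp \<gamma> - exp (- \<gamma>) - \<gamma>"
    using root of_real_eq_iff by metis
  then have "?r = \<gamma>"
    using strict_mono_eq[OF strict_mono_sinh_diff] by blast
  with zr show ?thesis by simp
qed

text \<open>Subtracting \<open>W c / (c - z)\<close> leaves a function holomorphic on the ball of
  radius \<open>R > c\<close>, whose coefficients are \<open>o(r^(-n))\<close> for every
  \<open>r < R\<close>. The limit is \<open>W c / c\<close> because \<open>1 / (c - z)\<close> has
  coefficients \<open>c^(-n-1)\<close>.\<close>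

lemma tendsto_fps_nth_simple_pole:
  fixes f W :: "complex \<Rightarrow> complex"
  assumes exp: "f has_fps_expansion F" and hol: "W holomorphic_on ball 0 R" and R: "0 < c" "c < R"
    and f: "\<And>z. z \<in> ball 0 R \<Longrightarrow> z \<noteq> of_real c \<Longrightarrow> f z = W z / (of_real c - z)"
  shows "\<exists>\<delta>. 0 < \<delta> \<and> \<delta> < 1 \<and>
    (\<lambda>n. (fps_nth F n * of_real c ^ n - W (of_real c) / of_real c) / of_real \<delta> ^ n) \<longlonglongrightarrow> 0"
proof -
  define a where "a = complex_of_real c"
  \<comment> \<open>The singularity of the difference quotient at \<open>a\<close> is removable, and
    \<open>f z = W a / (a - z) - H z\<close> near 0.\<close>
  define H where "H = (\<lambda>z. if z = a then deriv W a else (W z - W a) / (z - a))"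
  have a: "a \<noteq> 0" "a \<in> ball 0 R" using R by (auto simp: a_def)
  have holH: "H holomorphic_on ball 0 R"
    unfolding H_def by (rule pole_lemma) (use hol a in auto)
  define h where "h = fps_expansion H 0"
  have expH: "H has_fps_expansion h"
    unfolding h_def using holH R by (intro has_fps_expansion_fps_expansion[of "ball 0 R"]) auto
  have rad: "fps_conv_radius h \<ge> R"
    unfolding h_def by (rule conv_radius_fps_expansion) (use holH in simp)
  have ev: "\<forall>\<^sub>F z in nhds 0. f z = W a * inverse (a - z) - H z"
  proof -
    have "\<forall>\<^sub>F z in nhds (0::complex). z \<in> ball 0 R - {a}"
      by (rule eventually_nhds_in_open) (use R a in auto)
    then show ?thesis
    proof eventually_elim
      case (elim z)
      then have "a - z \<noteq> 0" "z - a \<noteq> 0" by auto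
      with elim f[of z] show ?case
        using minus_divide_right[of "W z - W a" "a - z"]
        by (simp add: H_def a_def[symmetric] divide_inverse algebra_simps)
    qed
  qed
  define K where "K = Abs_fps (\<lambda>n. 1 / a ^ Suc n)"
  have "(fps_const a - fps_X) * K = 1"
  proof (rule fps_ext)
    fix n show "fps_nth ((fps_const a - fps_X) * K) n = fps_nth 1 n"
      using a by (cases n) (auto simp: K_def algebra_simps)
  qed
  then have K: "inverse (fps_const a - fps_X) = K"
    by (rule fps_inverse_unique)
  have "(\<lambda>z. W a * inverse (a - z) - H z) has_fps_expansion fps_const (W a) * K - h"
    unfolding K[symmetric] using a expH
    by (intro has_fps_expansion_diff has_fps_expansion_cmult_left has_fps_expansion_inverse
        has_fps_expansion_const has_fps_expansion_fps_X) auto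
  then have "f has_fps_expansion fps_const (W a) * K - h"
    using has_fps_expansion_cong[OF ev refl] by blast
  then have F: "F = fps_const (W a) * K - h"
    using exp fps_expansion_unique_complex by blast
  \<comment> \<open>Any radius strictly between \<open>c\<close> and \<open>R\<close> serves; it
    yields the ratio \<open>c / r\<close> as \<delta>.\<close>
  define r where "r = (c + R) / 2"
  have r: "c < r" "r < R" "0 < r" using R by (auto simp: r_def)
  have "summable (\<lambda>n. fps_nth h n * of_real r ^ n)"
  proof (rule summable_fps)
    show "ereal (norm (complex_of_real r)) < fps_conv_radius h"
      using r rad by (intro less_le_trans[OF _ rad]) auto
  qed
  then have "(\<lambda>n. - (fps_nth h n * of_real r ^ n)) \<longlonglongrightarrow> - 0"
    by (intro tendsto_minus summable_LIMSEQ_zero)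
  moreover have "(fps_nth F n * of_real c ^ n - W (of_real c) / of_real c) / of_real (c / r) ^ n =
      - (fps_nth h n * of_real r ^ n)" for n
    using a r unfolding F a_def[symmetric] of_real_divide
    by (simp add: K_def field_simps)
  ultimately show ?thesis
    using r R by (intro exI[of _ "c / r"]) auto
qed

section \<open>Numerical bounds\<close>

text \<open>Bounding the exponential in the remainder by 3 leaves rational expressions that can be
  evaluated.\<close>

lemma exp_Taylor_bounds:
  fixes x :: real
  assumes "0 \<le> x" "x \<le> 1"
  shows "exp x \<le> (\<Sum>i\<le>n. x ^ i / fact i) + 3 * x ^ Suc n / fact n"
    and "(\<Sum>i\<le>n. x ^ i / fact i) - 3 * x ^ Suc n / fact n \<le> exp x"
proof -
  have "exp x \<le> 3"
    using assms exp_le by (auto intro: order_trans[of _ "exp 1"])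
  then have "exp x * x ^ Suc n / fact n \<le> 3 * x ^ Suc n / fact n"
    using assms by (intro divide_right_mono mult_right_mono) auto
  then have "\<bar>exp x - (\<Sum>i\<le>n. x ^ i / fact i)\<bar> \<le> 3 * x ^ Suc n / fact n"
    using Taylor_exp_field[of x n] assms by simp
  then show "exp x \<le> (\<Sum>i\<le>n. x ^ i / fact i) + 3 * x ^ Suc n / fact n"
    and "(\<Sum>i\<le>n. x ^ i / fact i) - 3 * x ^ Suc n / fact n \<le> exp x"
    by linarith+
qed

lemmas exp_Taylor_simps = atMost_nat_numeral fact_numeral power_divide

lemma ln_2_bounds: "0.69312 \<le> ln (2::real)" "ln (2::real) \<le> 0.69316"
proof -
  have "exp (0.69312::real) \<le> 2"
    by (rule order_trans[OF exp_Taylor_bounds(1)[of _ 10]]) (simp_all add: exp_Taylor_simps)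
  then show "0.69312 \<le> ln (2::real)" by (rule ln_ge_iff[THEN iffD2, rotated]) simp
  have "2 \<le> exp (0.69316::real)"
    by (rule order_trans[OF _ exp_Taylor_bounds(2)[of _ 10]]) (simp_all add: exp_Taylor_simps)
  then show "ln (2::real) \<le> 0.69316" using ln_le_cancel_iff[of 2 "exp (0.69316::real)"] by simp
qed

text \<open>The sign change locates \<gamma> within \<open>10^(-8)\<close>. Such precision leaves
  room for the bound on \<tau>, which is only about \<open>10^(-7)\<close> above the lower end of
  its tolerance interval.\<close>

lemma sc_root_bracket:
  "exp 0.81409679 - exp (- 0.81409679) - 0.81409679 < (1 :: real)"
  "1 < exp 0.8140968 - exp (- 0.8140968) - (0.8140968 :: real)"
  "2.257136083 \<le> exp (0.81409679 :: real)" "exp (0.8140968 :: real) \<le> 2.257136107"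
proof -
  \<comment> \<open>Writing each argument as 0.814 plus an offset below 0.0001 confines the degree
    14 polynomial to a short decimal; degree 2 suffices for the offset.\<close>
  have base: "exp (0.814 :: real) \<le> 2.2569176259" "2.25691762588 \<le> exp (0.814 :: real)"
    by (rule order_trans[OF exp_Taylor_bounds(1)[of _ 14]]; simp add: exp_Taylor_simps)
      (rule order_trans[OF _ exp_Taylor_bounds(2)[of _ 14]]; simp add: exp_Taylor_simps)
  have offset: "exp (0.00009679 :: real) \<le> 1.000096794686" "exp (0.0000968 :: real) \<le> 1.000096804687"
    by (rule order_trans[OF exp_Taylor_bounds(1)[of _ 2]]; simp add: exp_Taylor_simps)+
  have offset': "1.000096794682 \<le> exp (0.00009679 :: real)" "1.000096804683 \<le> exp (0.0000968 :: real)"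
    by (rule order_trans[OF _ exp_Taylor_bounds(2)[of _ 2]]; simp add: exp_Taylor_simps)+
  have split: "exp (0.81409679 :: real) = exp 0.814 * exp 0.00009679"
    "exp (0.8140968 :: real) = exp 0.814 * exp 0.0000968"
    by (simp_all flip: exp_add)
  have 1: "exp (0.81409679 :: real) \<le> 2.257136084" "exp (0.8140968 :: real) \<le> 2.257136107"
    unfolding split by (rule order_trans[OF mult_mono[OF base(1) offset(1)]] order_trans[OF mult_mono[OF base(1) offset(2)]]; simp)+
  show 2: "2.257136083 \<le> exp (0.81409679 :: real)"
    unfolding split by (rule order_trans[OF _ mult_mono[OF base(2) offset'(1)]]; simp)
  have 3: "2.257136106 \<le> exp (0.8140968 :: real)"
    unfolding split by (rule order_trans[OF _ mult_mono[OF base(2) offset'(2)]]; simp)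
  show "exp (0.8140968 :: real) \<le> 2.257136107" by (rule 1)
  have "0.443039304 \<le> exp (- 0.81409679 :: real)"
    using le_imp_inverse_le[OF 1(1)] by (simp add: exp_minus)
  then show "exp 0.81409679 - exp (- 0.81409679) - 0.81409679 < (1 :: real)"
    using 1(1) by simp
  have "exp (- 0.8140968 :: real) \<le> 0.4430393"
    using le_imp_inverse_le[OF 3] by (simp add: exp_minus)
  then show "1 < exp 0.8140968 - exp (- 0.8140968) - (0.8140968 :: real)"
    using 3 by simp
qed

lemma sc_root_exists:
  obtains \<gamma> :: real where "exp \<gamma> - exp (- \<gamma>) - \<gamma> = 1" "0.81409679 \<le> \<gamma>" "\<gamma> \<le> 0.8140968"
proof -
  have "\<exists>x\<ge>0.81409679. x \<le> 0.8140968 \<and> exp x - exp (- x) - x = (1 :: real)"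
    using sc_root_bracket by (intro IVT') (auto intro!: continuous_intros)
  with that show ?thesis by blast
qed

section \<open>The dominant pole\<close>

text \<open>The two equations differ by the non-vanishing factor \<open>exp x\<close>; the second
  has a monotone left side.\<close>

lemma sc_denominator_eq_0_iff:
  fixes x :: real
  shows "exp (2 * x) = 1 + (1 + x) * exp x \<longleftrightarrow> exp x - exp (- x) - x = 1"
proof -
  have "exp (2 * x) - (1 + (1 + x) * exp x) = exp x * (exp x - exp (- x) - x - 1)"
    by (simp add: algebra_simps flip: exp_add)
  then show ?thesis
    by (metis eq_iff_diff_eq_0 exp_not_eq_zero mult_eq_0_iff)
qed

text \<open>The equation for \<open>sc_egf\<close> holds everywhere, at its poles thanks to \<open>x / 0 = 0\<close>.\<close>

lemma sc_egf_simple_pole: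
  fixes \<gamma> :: real
  assumes root: "exp \<gamma> - exp (- \<gamma>) - \<gamma> = 1" and pos: "0 < \<gamma>"
  obtains W R where "W holomorphic_on ball 0 R" "\<gamma> < R"
    "sc_egf = (\<lambda>z. W z / (of_real \<gamma> - z))" "W (of_real \<gamma>) = of_real (1 / (2 * exp \<gamma> - 2 - \<gamma>))"
proof -
  define a where "a = complex_of_real \<gamma>"
  define g where "g = (\<lambda>z::complex. exp z - exp (- z) - z)"
  have g_a: "g a = 1"
    using arg_cong[OF root, of complex_of_real] by (simp add: g_def a_def exp_of_real flip: of_real_minus)
  have deriv_g: "deriv g a = of_real (2 * exp \<gamma> - 2 - \<gamma>)"
  proof -
    have "(g has_field_derivative exp a + exp (- a) - 1) (at a)"
      unfolding g_def by (auto intro!: derivative_eq_intros)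
    moreover have "exp a + exp (- a) - 1 = of_real (exp \<gamma> + exp (- \<gamma>) - 1)"
      by (simp add: a_def exp_of_real flip: of_real_minus)
    \<comment> \<open>The root equation eliminates \<open>exp (- \<gamma>)\<close>.\<close>
    moreover have "exp \<gamma> + exp (- \<gamma>) - 1 = 2 * exp \<gamma> - 2 - \<gamma>"
      using root by simp
    ultimately show ?thesis by (metis DERIV_imp_deriv)
  qed
  \<comment> \<open>The entire function with \<open>g z - 1 = (z - a) * Q z\<close>; its zeros are
    the remaining poles of \<open>sc_egf\<close>.\<close>
  define Q where "Q = (\<lambda>z. if z = a then deriv g a else (g z - g a) / (z - a))"
  have hol: "Q holomorphic_on UNIV"
    unfolding Q_def by (rule pole_lemma) (auto simp: g_def intro!: holomorphic_intros)
  have nz: "Q z \<noteq> 0" if "z \<in> cball 0 \<gamma>" for z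
  proof (cases "z = a")
    case True
    \<comment> \<open>By \<open>exp \<gamma> \<ge> 1 + \<gamma>\<close> this derivative is at least
      \<gamma>, so the pole is simple.\<close>
    have "2 * exp \<gamma> - 2 - \<gamma> \<noteq> 0" using exp_ge_add_one_self[of \<gamma>] pos by linarith
    then show ?thesis using True deriv_g by (simp add: Q_def del: of_real_diff)
  next
    case False
    then have "g z \<noteq> 1"
      using sc_root_unique_in_cball[OF root, of z] that by (auto simp: g_def a_def)
    with False g_a show ?thesis by (simp add: Q_def)
  qed
  have opn: "open {z. Q z \<noteq> 0}"
    using hol by (intro open_Collect_neq holomorphic_on_imp_continuous_on continuous_on_const)
  have sub: "cball 0 \<gamma> \<subseteq> {z. Q z \<noteq> 0}" using nz by blast
  obtain \<epsilon> where eps: "\<epsilon> > 0" "(\<Union>z\<in>cball 0 \<gamma>. ball z \<epsilon>) \<subseteq> {z. Q z \<noteq> 0}"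
    by (rule compact_subset_open_imp_ball_epsilon_subset[OF compact_cball opn sub])
  define W where "W = (\<lambda>z. 1 / Q z)"
  have "Q z \<noteq> 0" if z: "z \<in> ball 0 (\<gamma> + \<epsilon>)" for z
  proof (cases "norm z \<le> \<gamma>")
    case False
    \<comment> \<open>The radial projection of \<open>z\<close> to the circle of radius \<gamma>, at
      distance \<open>norm z - \<gamma>\<close> from \<open>z\<close>.\<close>
    define y where "y = of_real (\<gamma> / norm z) * z"
    have "norm y = \<gamma>" using False pos by (auto simp: y_def norm_mult norm_divide)
    moreover have "dist y z < \<epsilon>"
    proof -
      have "y - z = of_real (\<gamma> / norm z - 1) * z" by (simp add: y_def algebra_simps)
      then have "dist y z = \<bar>\<gamma> / norm z - 1\<bar> * norm z"
        unfolding dist_norm by (simp only: norm_mult norm_of_real)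
      also have "\<dots> = norm z - \<gamma>"
        using False pos by (auto simp: abs_if field_simps)
      finally show ?thesis using z by simp
    qed
    ultimately have "z \<in> (\<Union>y\<in>cball 0 \<gamma>. ball y \<epsilon>)"
      by (intro UN_I[of y]) auto
    with eps(2) show ?thesis by blast
  qed (use nz in auto)
  then have "W holomorphic_on ball 0 (\<gamma> + \<epsilon>)"
    unfolding W_def using holomorphic_on_subset[OF hol] by (intro holomorphic_intros) auto
  moreover have "sc_egf = (\<lambda>z. W z / (of_real \<gamma> - z))"
  proof
    fix z
    have "1 + z + exp (- z) - exp z = (a - z) * Q z"
    proof (cases "z = a")
      case True
      with g_a show ?thesis by (simp add: g_def algebra_simps)
    next
      case False
      then have "(z - a) * Q z = g z - 1" by (simp add: Q_def g_a)
      then show ?thesis by (simp add: g_def algebra_simps)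
    qed
    then show "sc_egf z = W z / (of_real \<gamma> - z)"
      by (simp add: sc_egf_eq W_def a_def[symmetric] divide_inverse mult.commute)
  qed
  moreover have "W (of_real \<gamma>) = of_real (1 / (2 * exp \<gamma> - 2 - \<gamma>))"
    unfolding W_def a_def[symmetric] Q_def using deriv_g by simp
  ultimately show ?thesis using that[of W "\<gamma> + \<epsilon>"] eps(1) by simp
qed

text \<open>The first expansion has an exponentially small error around the true limit
  \<open>\<tau> / \<gamma>\<close>. In the second, \<open>\<delta> powi (- int n)\<close> is
  unbounded and absorbs the constant \<open>\<tau> / \<gamma> - \<tau>\<close>.\<close>

theorem proposition34:
  fixes sc :: "nat \<Rightarrow> nat"
  defines "sc \<equiv> sc_dim TYPE('k::field)"
  shows "(\<forall>\<^sub>F x in nhds 0. (\<lambda>n. of_nat (sc n) * x ^ n / fact n) sums sc_egf x) \<and>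
    (\<exists>\<gamma> \<tau> :: real.
      {x. 0 < x \<and> exp (2 * x) = 1 + (1 + x) * exp x} = {\<gamma>} \<and>
      \<bar>\<gamma> - 0.814097\<bar> \<le> 0.0000005 \<and>
      \<bar>\<gamma> / ln 2 - 1.1745\<bar> \<le> 0.00005 \<and>
      complex_of_real \<tau> = - residue sc_egf (complex_of_real \<gamma>) \<and>
      \<bar>\<tau> - 0.588175\<bar> \<le> 0.0000005 \<and>
      (\<exists>\<delta>. 0 < \<delta> \<and> \<delta> < 1 \<and>
        (\<exists>e \<in> o(\<lambda>n. \<delta> ^ n).
          \<forall>n. real (sc n) = fact n * \<gamma> powi (- int n) * (\<tau> / \<gamma> + e n)) \<and>
        (\<exists>e \<in> o(\<lambda>n. \<delta> powi (- int n)).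
          \<forall>n. real (sc n) = fact n * \<gamma> powi (- int n) * (\<tau> + e n))))"
proof -
  have sc: "of_nat (sc n) = (fact n * fps_nth sc_fps n :: complex)" for n
    unfolding sc_def by (rule sc_dim_eq_fact_fps)
  have series: "\<forall>\<^sub>F x in nhds 0. (\<lambda>n. of_nat (sc n) * x ^ n / fact n) sums sc_egf x"
  proof -
    have "fps_conv_radius (sc_fps :: complex fps) > 0"
      and eval: "\<forall>\<^sub>F x in nhds 0. eval_fps sc_fps x = sc_egf x"
      using has_fps_expansion_sc_egf by (auto simp: has_fps_expansion_def)
    then have "\<forall>\<^sub>F x in nhds (0::complex). x \<in> eball 0 (fps_conv_radius (sc_fps :: complex fps))"
      by (intro eventually_nhds_in_open) (auto simp: zero_ereal_def)
    with eval show ?thesis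
    proof eventually_elim
      case (elim x)
      then have "(\<lambda>n. fps_nth sc_fps n * x ^ n) sums sc_egf x"
        using sums_eval_fps[of x sc_fps] by (simp add: in_eball_iff)
      then show ?case by (simp add: sc)
    qed
  qed
  obtain \<gamma> :: real where root: "exp \<gamma> - exp (- \<gamma>) - \<gamma> = 1"
    and bounds: "0.81409679 \<le> \<gamma>" "\<gamma> \<le> 0.8140968"
    by (rule sc_root_exists)
  then have pos: "0 < \<gamma>" by simp
  define \<tau> where "\<tau> = 1 / (2 * exp \<gamma> - 2 - \<gamma>)"
  obtain W R where W: "W holomorphic_on ball 0 R" "\<gamma> < R"
    and egf: "sc_egf = (\<lambda>z. W z / (of_real \<gamma> - z))" and W_\<gamma>: "W (of_real \<gamma>) = of_real \<tau>"
    using sc_egf_simple_pole[OF root pos] unfolding \<tau>_def by metis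
  have "{x. 0 < x \<and> exp (2 * x) = 1 + (1 + x) * exp x} = {\<gamma>}"
  proof -
    have "exp x - exp (- x) - x = 1 \<longleftrightarrow> x = \<gamma>" for x
      using strict_mono_eq[OF strict_mono_sinh_diff, of x \<gamma>] root by simp
    then show ?thesis using pos by (auto simp: sc_denominator_eq_0_iff)
  qed
  moreover have "\<bar>\<gamma> - 0.814097\<bar> \<le> 0.0000005"
    using bounds by (auto simp: abs_if)
  moreover have "\<bar>\<gamma> / ln 2 - 1.1745\<bar> \<le> 0.00005"
  proof -
    have "1.17445 * ln 2 \<le> \<gamma>" "\<gamma> \<le> 1.17455 * ln 2"
      using bounds ln_2_bounds by auto
    then have "1.17445 \<le> \<gamma> / ln 2" "\<gamma> / ln 2 \<le> 1.17455"
      by (simp_all add: field_simps)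
    then show ?thesis by (auto simp: abs_if)
  qed
  moreover have "complex_of_real \<tau> = - residue sc_egf (complex_of_real \<gamma>)"
  proof -
    \<comment> \<open>Passing to the denominator \<open>z - \<gamma>\<close> of the usual residue
      brings in the minus sign.\<close>
    have "sc_egf = (\<lambda>z. - W z / (z - of_real \<gamma>))"
      unfolding egf by (metis minus_diff_eq minus_divide_divide minus_minus)
    moreover have "residue (\<lambda>z. - W z / (z - of_real \<gamma>)) (of_real \<gamma>) = - W (of_real \<gamma>)"
      by (rule residue_simple[of "ball 0 R"]) (use W pos in \<open>auto intro!: holomorphic_intros\<close>)
    ultimately show ?thesis by (simp add: W_\<gamma>)
  qed
  moreover have "\<bar>\<tau> - 0.588175\<bar> \<le> 0.0000005"
  proof -
    have "2.257136083 \<le> exp \<gamma>"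
      by (rule order_trans[OF sc_root_bracket(3)]) (use bounds in simp)
    moreover have "exp \<gamma> \<le> 2.257136107"
      by (rule order_trans[OF _ sc_root_bracket(4)]) (use bounds in simp)
    ultimately have "1.7001753 \<le> 2 * exp \<gamma> - 2 - \<gamma>" "2 * exp \<gamma> - 2 - \<gamma> \<le> 1.7001755"
      using bounds by simp_all
    then have "\<tau> \<le> 0.5881755" "0.5881745 \<le> \<tau>"
      by (simp_all add: \<tau>_def field_simps)
    then show ?thesis by (auto simp: abs_if)
  qed
  moreover obtain \<delta> :: real where \<delta>: "0 < \<delta>" "\<delta> < 1"
    and lim: "(\<lambda>n. (fps_nth sc_fps n * of_real \<gamma> ^ n - W (of_real \<gamma>) / of_real \<gamma>) / of_real \<delta> ^ n) \<longlonglongrightarrow> 0"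
    using tendsto_fps_nth_simple_pole[OF has_fps_expansion_sc_egf W(1) pos W(2) fun_cong[OF egf]] by blast
  define e where "e = (\<lambda>n. real (sc n) / fact n * \<gamma> ^ n - \<tau> / \<gamma>)"
  have eq: "real (sc n) = fact n * \<gamma> powi (- int n) * (\<tau> / \<gamma> + e n)" for n
    using pos by (simp add: e_def power_int_minus field_simps)
  have "e \<in> o(\<lambda>n. \<delta> ^ n)"
  proof (rule smalloI_tendsto)
    have "fps_nth sc_fps n = complex_of_real (real (sc n) / fact n)" for n
      using sc[of n] by (simp add: field_simps)
    then have "(\<lambda>n. complex_of_real (e n / \<delta> ^ n)) \<longlonglongrightarrow> of_real 0"
      using lim by (simp add: W_\<gamma> e_def)
    then show "(\<lambda>n. e n / \<delta> ^ n) \<longlonglongrightarrow> 0"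
      by (rule tendsto_of_real_iff[THEN iffD1])
  qed (use \<delta> in auto)
  moreover have "(\<lambda>n. \<tau> / \<gamma> - \<tau> + e n) \<in> o(\<lambda>n. \<delta> powi (- int n))"
  proof (rule smalloI_tendsto)
    have "(\<lambda>n. \<delta> ^ n) \<longlonglongrightarrow> 0" using \<delta> by (intro LIMSEQ_power_zero) auto
    moreover have "(\<lambda>n. e n / \<delta> ^ n) \<longlonglongrightarrow> 0"
      by (rule smalloD_tendsto) fact
    \<comment> \<open>Dividing by \<open>\<delta> powi (- int n)\<close> multiplies by
      \<open>\<delta> ^ n\<close>, which tends to 0; writing \<open>e n\<close> as a quotient times
      \<open>\<delta> ^ n\<close> shows that it tends to 0 too.\<close>
    ultimately have "(\<lambda>n. ((\<tau> / \<gamma> - \<tau>) + e n / \<delta> ^ n * \<delta> ^ n) * \<delta> ^ n) \<longlonglongrightarrow> ((\<tau> / \<gamma> - \<tau>) + 0 * 0) * 0"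
      by (intro tendsto_mult tendsto_add tendsto_const)
    then show "(\<lambda>n. (\<tau> / \<gamma> - \<tau> + e n) / \<delta> powi (- int n)) \<longlonglongrightarrow> 0"
      using \<delta> by (simp add: power_int_minus divide_inverse[of _ "inverse _"])
  qed (use \<delta> in auto)
  moreover have "real (sc n) = fact n * \<gamma> powi (- int n) * (\<tau> + (\<tau> / \<gamma> - \<tau> + e n))" for n
    using eq[of n] by simp
  ultimately show ?thesis
    using series \<delta> eq by (intro conjI exI[of _ \<gamma>] exI[of _ \<tau>] exI[of _ \<delta>]) (auto intro!: bexI)
qed

end
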